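(* Let $T$ be a tree with diameter $k\ge 2$ and order $q\ge k+1\ge 3$. Then for every $n\ge q$, $$\mathrm{ex}(n,\{C_3,\dots,C_{k+1}\})\;\le\;\mathrm{st}(n,T)\;\le\;\mathrm{ex}(n,\{C_3,\dots,C_{k+1}\})+(q-1)n .$$
   Context: Graphs are finite and simple; the order of a graph is its number of vertices; $C_i$ is the cycle on $i$ vertices. $\mathrm{ex}(n,\mathcal F)$ is the maximum number of edges of a graph on $n$ vertices containing no (not necessarily induced) copy of any member of $\mathcal F$. For a non-complete graph $G$ on $r$ vertices and $n\ge r$, $\mathrm{st}(n,G)$ is the largest $m$ for which there is a graph $H$ with $n$ vertices and $m$ edges such that no subgraph $F\subseteq H$ on exactly $r$ vertices contains $G$ as a proper subgraph. *)

theory Defs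
  imports "Graph_Theory.Graph_Theory"
begin

text \<open>
  Finite simple graphs are modelled as \<^locale>\<open>pair_graph\<close>: finite, loop-free, symmetric
  digraphs without parallel arcs.  The library's \<open>cycle\<close> admits the closed walk \<open>a, b, a\<close>, so the
  library's \<open>forest\<close> and \<open>tree\<close> do not describe undirected trees in this representation; cycles
  are therefore treated below as copies of the graphs \<open>C\<^sub>i\<close>.
\<close>

text \<open>Each undirected edge is represented by two opposite arcs, but is counted only once.\<close>

definition edges :: "'a pair_pre_digraph \<Rightarrow> 'a set set" where
  "edges G = (\<lambda>(u, v). {u, v}) ` parcs G"

definition contains_copy :: "'b pair_pre_digraph \<Rightarrow> 'a pair_pre_digraph \<Rightarrow> bool" where
  "contains_copy H G \<longleftrightarrow>
     (\<exists>G' :: 'b pair_pre_digraph. subgraph (with_proj G') (with_proj H) \<and>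
        digraph_iso (with_proj G) (with_proj G'))"

definition contains_proper_copy :: "'b pair_pre_digraph \<Rightarrow> 'a pair_pre_digraph \<Rightarrow> bool" where
  "contains_proper_copy H G \<longleftrightarrow>
     (\<exists>G' :: 'b pair_pre_digraph. subgraph (with_proj G') (with_proj H) \<and> G' \<noteq> H \<and>
        digraph_iso (with_proj G) (with_proj G'))"

text \<open>This is a simple graph only for \<open>i \<ge> 3\<close>.\<close>

definition cycle_graph :: "nat \<Rightarrow> nat pair_pre_digraph" where
  "cycle_graph i = \<lparr> pverts = {..<i},
     parcs = {(a, b). a < i \<and> b < i \<and> (b = (a + 1) mod i \<or> a = (b + 1) mod i)} \<rparr>"

definition undirected_tree :: "'a pair_pre_digraph \<Rightarrow> bool" where
  "undirected_tree T \<longleftrightarrow> pair_graph T \<and> Digraph_Component.connected (with_proj T) \<and>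
     (\<forall>i\<ge>3. \<not> contains_copy T (cycle_graph i))"

text \<open>With unit arc weights, \<open>\<mu>\<close> is the usual distance: the length of a shortest walk.\<close>

definition graph_diameter :: "'a pair_pre_digraph \<Rightarrow> ereal" where
  "graph_diameter G =
     (SUP u \<in> pverts G. SUP v \<in> pverts G. wf_digraph.\<mu> (with_proj G) (\<lambda>_. 1) u v)"

text \<open>
  Every finite graph is isomorphic to one with vertices in \<^typ>\<open>nat\<close>, so it suffices to let the
  host graphs range over these.
\<close>

definition ex_number :: "nat \<Rightarrow> 'a pair_pre_digraph set \<Rightarrow> nat" where
  "ex_number n \<F> = Max {card (edges H) | H :: nat pair_pre_digraph.
     pair_graph H \<and> card (pverts H) = n \<and> (\<forall>F\<in>\<F>. \<not> contains_copy H F)}"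

text \<open>Only meaningful for non-complete graphs \<open>G\<close> with at most \<open>n\<close> vertices.\<close>

definition st_number :: "nat \<Rightarrow> 'a pair_pre_digraph \<Rightarrow> nat" where
  "st_number n G = Max {card (edges H) | H :: nat pair_pre_digraph.
     pair_graph H \<and> card (pverts H) = n \<and>
     (\<forall>F :: nat pair_pre_digraph.
        pair_graph F \<and> subgraph (with_proj F) (with_proj H) \<and> card (pverts F) = card (pverts G)
        \<longrightarrow> \<not> contains_proper_copy F G)}"

end

theory Submission
  imports Defs
begin

text \<open>
  A graph \<open>H\<close> is admissible for \<open>st(n, T)\<close> iff every copy of \<open>T\<close> in \<open>H\<close> is induced: a subgraph \<open>F\<close> on
  \<open>q\<close> vertices that properly contains a copy of \<open>T\<close> is spanned by that copy, so it has an extra edge.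

  Lower bound.  Let \<open>H\<close> have no cycle of length \<open>3, \<dots>, k + 1\<close>.  If a copy of \<open>T\<close> in \<open>H\<close> had an extra
  edge joining the images of \<open>u\<close> and \<open>v\<close>, that edge would close the image of a \<open>u\<close>--\<open>v\<close> path of \<open>T\<close>, of
  length between \<open>2\<close> and \<open>k\<close>, to a forbidden cycle.  So \<open>H\<close> is admissible for \<open>st(n, T)\<close>
  (\<open>no_proper_copy_if_no_short_circuit\<close>).

  Upper bound.  Let every copy of \<open>T\<close> in \<open>H\<close> be induced.  As long as some non-isolated vertex has degree
  less than \<open>q - 1\<close>, delete all edges at it.  At most \<open>n\<close> vertices are treated, so at most \<open>(q - 1) n\<close> edges
  are lost, and in the remaining graph every non-isolated vertex has degree at least \<open>q - 1\<close>
  (\<open>prune_low_degree\<close>).  Such a graph admits greedy embedding of trees on \<open>q\<close> vertices: any embedding of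
  a subtree extends, one leaf at a time (\<open>extend_tree_embedding\<close>).  If it contained a cycle of length
  \<open>i \<in> {3..k + 1}\<close>, one could map a path of \<open>T\<close> with \<open>i\<close> vertices, which exists by the diameter hypothesis,
  onto the vertices of the cycle and extend; the edge of the cycle that closes the path would then make
  this copy of \<open>T\<close> non-induced (\<open>no_short_circuit_if_large_degree\<close>).  Hence the remaining graph has at
  most \<open>ex(n, {C\<^sub>3, \<dots>, C\<^sub>k\<^sub>+\<^sub>1})\<close> edges.
\<close>

section \<open>Paths and circuits as vertex lists\<close>

text \<open>
  Paths and circuits of a relation, given by the list of their pairwise distinct vertices.  A circuit is
  a path with at least three vertices whose last vertex is joined to the first one.
\<close>

definition path_in :: "'a rel \<Rightarrow> 'a list \<Rightarrow> bool" where
  "path_in E p \<longleftrightarrow> distinct p \<and> successively (\<lambda>x y. (x, y) \<in> E) p"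

definition circuit :: "'a rel \<Rightarrow> 'a list \<Rightarrow> bool" where
  "circuit E p \<longleftrightarrow> 3 \<le> length p \<and> path_in E p \<and> (last p, hd p) \<in> E"

lemma path_in_mono: "path_in E p \<Longrightarrow> E \<subseteq> F \<Longrightarrow> path_in F p"
  unfolding path_in_def by (auto elim!: successively_mono)

lemma circuit_mono: "circuit E p \<Longrightarrow> E \<subseteq> F \<Longrightarrow> circuit F p"
  unfolding circuit_def by (auto intro: path_in_mono)

lemma path_in_appendD1: "path_in E (p @ r) \<Longrightarrow> path_in E p"
  unfolding path_in_def by (auto simp: successively_append_iff)

lemma path_in_take: "path_in E p \<Longrightarrow> path_in E (take m p)"
  by (metis append_take_drop_id path_in_appendD1)

lemma path_in_map:
  assumes "path_in E p" "inj_on f (set p)" "\<And>x y. (x, y) \<in> E \<Longrightarrow> (f x, f y) \<in> D"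
  shows "path_in D (map f p)"
  using assms unfolding path_in_def
  by (auto simp: distinct_map successively_map elim!: successively_mono)

lemma rtrancl_imp_path_in:
  assumes "(a, b) \<in> E\<^sup>*"
  shows "\<exists>p. p \<noteq> [] \<and> hd p = a \<and> last p = b \<and> path_in E p \<and> set p \<subseteq> insert a (Range E)"
  using assms
proof (induction rule: rtrancl_induct)
  case base
  show ?case by (rule exI[of _ "[a]"]) (auto simp: path_in_def)
next
  case (step b c)
  then obtain p where p: "p \<noteq> []" "hd p = a" "last p = b" "path_in E p" "set p \<subseteq> insert a (Range E)"
    by blast
  show ?case
  proof (cases "c \<in> set p")
    case True
    then obtain r s where "p = (r @ [c]) @ s" by (auto simp: in_set_conv_decomp)
    moreover from this have "path_in E (r @ [c])" using p(4) path_in_appendD1 by metis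
    ultimately show ?thesis
      using p by (intro exI[of _ "r @ [c]"]) (auto simp: hd_append split: if_splits)
  next
    case False
    with p step(2) show ?thesis
      by (intro exI[of _ "p @ [c]"]) (auto simp: path_in_def successively_append_iff)
  qed
qed

text \<open>In a forest, a path with at least three vertices is never closed by an edge.\<close>

lemma ends_not_adjacent:
  assumes "sym E" "\<nexists>c. circuit E c" "path_in E p" "3 \<le> length p"
  shows "(hd p, last p) \<notin> E"
  using assms by (metis circuit_def symD)

text \<open>The vertex set \<open>S\<close> induces a connected subgraph; the empty set is included.\<close>

definition connected_in :: "'a rel \<Rightarrow> 'a set \<Rightarrow> bool" where
  "connected_in E S \<longleftrightarrow> (\<forall>a\<in>S. \<forall>b\<in>S. (a, b) \<in> (Restr E S)\<^sup>*)"

lemma connected_in_insert: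
  assumes "connected_in E S" "u \<in> S" "(u, v) \<in> E" "sym E"
  shows "connected_in E (insert v S)"
proof -
  let ?R = "Restr E (insert v S)"
  have S: "(a, b) \<in> ?R\<^sup>*" if "a \<in> S" "b \<in> S" for a b
    using that assms(1) rtrancl_mono[of "Restr E S" ?R] unfolding connected_in_def by blast
  have uv: "(u, v) \<in> ?R" "(v, u) \<in> ?R" using assms by (auto dest: symD)
  have "(a, v) \<in> ?R\<^sup>*" "(v, a) \<in> ?R\<^sup>*" if "a \<in> S" for a
    using S[OF that assms(2)] S[OF assms(2) that] uv
    by (auto intro: rtrancl_into_rtrancl converse_rtrancl_into_rtrancl)
  with S show ?thesis unfolding connected_in_def by auto
qed

lemma path_in_connected_in:
  assumes "path_in E p" "sym E"
  shows "connected_in E (set p)"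
  using assms(1)
proof (induction p)
  case Nil
  show ?case by (simp add: connected_in_def)
next
  case (Cons y p)
  show ?case
  proof (cases "p = []")
    case True
    then show ?thesis by (simp add: connected_in_def)
  next
    case False
    with Cons.prems have "path_in E p" "(y, hd p) \<in> E"
      by (auto simp: path_in_def successively_Cons)
    with False Cons.IH assms(2) show ?thesis
      by (auto intro!: connected_in_insert[of E "set p" "hd p"] dest: symD)
  qed
qed

text \<open>A vertex of a forest has at most one neighbour in a connected set not containing it.\<close>

lemma unique_neighbour:
  assumes "sym E" "\<nexists>c. circuit E c" "connected_in E S"
    and "v \<notin> S" "u \<in> S" "u' \<in> S" "(u, v) \<in> E" "(u', v) \<in> E"
  shows "u = u'"
proof (rule ccontr)
  assume "u \<noteq> u'"
  have "(u, u') \<in> (Restr E S)\<^sup>*" using assms unfolding connected_in_def by blast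
  from rtrancl_imp_path_in[OF this] obtain p where p: "p \<noteq> []" "hd p = u" "last p = u'"
      "path_in (Restr E S) p" "set p \<subseteq> insert u (Range (Restr E S))" by blast
  have "set p \<subseteq> S" using p(5) assms(5) by auto
  moreover have "2 \<le> length p"
    using p(1-3) \<open>u \<noteq> u'\<close> by (cases p; cases "tl p") auto
  moreover have "path_in E p" using p(4) by (rule path_in_mono) auto
  ultimately have "circuit E (p @ [v])"
    using p(1-3) assms unfolding circuit_def path_in_def
    by (auto simp: successively_append_iff dest: symD)
  with assms(2) show False by blast
qed

section \<open>Greedy embedding of trees\<close>

text \<open>
  A forest has no edges between vertices of a path other than those of the path, so mapping a path of a
  forest onto any other path with the same number of vertices preserves adjacency.
\<close>

lemma map_path_onto_path:
  assumes "sym E" "irrefl E" "\<nexists>c. circuit E c" "sym D"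
    and "path_in E p" "path_in D c" "length p = length c"
  shows "\<exists>f. map f p = c \<and> (\<forall>u\<in>set p. \<forall>v\<in>set p. (u, v) \<in> E \<longrightarrow> (f u, f v) \<in> D)"
  using assms(5-7)
proof (induction p arbitrary: c)
  case Nil
  then show ?case by auto
next
  case (Cons y p)
  then obtain z d where c: "c = z # d" by (cases c) auto
  have vp: "path_in E p" "path_in D d" "y \<notin> set p"
    using Cons.prems c by (auto simp: path_in_def successively_Cons)
  have "length p = length d" using Cons.prems(3) c by simp
  from Cons.IH[OF vp(1,2) this] obtain f where f: "map f p = d"
      "\<forall>u\<in>set p. \<forall>v\<in>set p. (u, v) \<in> E \<longrightarrow> (f u, f v) \<in> D" by blast
  let ?f = "f(y := z)"
  have yv: "(z, f v) \<in> D" if "v \<in> set p" "(y, v) \<in> E" for v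
  proof -
    have ne: "p \<noteq> []" using that by auto
    then have hd: "(y, hd p) \<in> E" "(z, hd d) \<in> D"
      using Cons.prems c by (auto simp: path_in_def successively_Cons)
    have "v = hd p"
      using unique_neighbour[OF assms(1,3) path_in_connected_in[OF vp(1) assms(1)] vp(3)]
        that hd(1) ne assms(1) by (metis hd_in_set symD)
    then show ?thesis using hd(2) f(1) ne by (metis hd_map)
  qed
  have vy: "(f v, z) \<in> D" if "v \<in> set p" "(v, y) \<in> E" for v
    using yv that assms(1,4) by (meson symD)
  have "map ?f (y # p) = c" using f(1) vp(3) c by simp
  moreover have "(?f u, ?f v) \<in> D" if "u \<in> set (y # p)" "v \<in> set (y # p)" "(u, v) \<in> E" for u v
    using that yv vy f(2) vp(3) assms(2) by (auto simp: irrefl_def)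
  ultimately show ?case by blast
qed

text \<open>
  If every non-isolated vertex of \<open>D\<close> has at least \<open>|V| - 1\<close> neighbours, then every embedding of a
  connected part \<open>S\<close> of a tree on \<open>V\<close> into \<open>D\<close> extends to the whole tree.
\<close>

lemma extend_tree_embedding:
  fixes E :: "'a rel" and D :: "'b rel"
  assumes V: "finite V" "E \<subseteq> V \<times> V" "sym E" "irrefl E" "\<nexists>c. circuit E c"
    "\<And>a b. a \<in> V \<Longrightarrow> b \<in> V \<Longrightarrow> (a, b) \<in> E\<^sup>*"
    and D: "finite D" "sym D" "irrefl D" "\<And>x. x \<in> Domain D \<Longrightarrow> card V - 1 \<le> card (D `` {x})"
    and S: "S \<subseteq> V" "S \<noteq> {}" "connected_in E S"
    and f: "inj_on f S" "f ` S \<subseteq> Domain D"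
    "\<And>u v. u \<in> S \<Longrightarrow> v \<in> S \<Longrightarrow> (u, v) \<in> E \<Longrightarrow> (f u, f v) \<in> D"
  shows "\<exists>g. (\<forall>x\<in>S. g x = f x) \<and> inj_on g V \<and> (\<forall>(u, v)\<in>E. (g u, g v) \<in> D)"
  using S f
proof (induction "card (V - S)" arbitrary: S f rule: less_induct)
  case less
  note S = less.prems(1-3) and f = less.prems(4-6)
  show ?case
  proof (cases "S = V")
    case True
    with f V(2) show ?thesis by (intro exI[of _ f]) blast
  next
    case False
    with S obtain a b where ab: "a \<in> S" "b \<in> V" "b \<notin> S" by blast
    have "\<exists>u v. u \<in> S \<and> v \<notin> S \<and> (u, v) \<in> E"
    proof (rule ccontr)
      assume *: "\<not> ?thesis"
      have "(a, b) \<in> E\<^sup>*" using V(6) ab S(1) by blast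
      then have "b \<in> S" by (induction rule: rtrancl_induct) (use ab * in auto)
      with ab show False by simp
    qed
    then obtain u v where uv: "u \<in> S" "v \<notin> S" "(u, v) \<in> E" by blast
    have vV: "v \<in> V" using uv V(2) by auto
    \<comment> \<open>Fewer than \<open>|V| - 1\<close> vertices other than \<open>f u\<close> are occupied, so \<open>f u\<close> has an unused neighbour \<open>y\<close>.\<close>
    have finS: "finite S" using S V(1) finite_subset by blast
    have "S \<subset> V" using S False by blast
    then have "card S < card V" using V(1) psubset_card_mono by blast
    moreover have "card (f ` (S - {u})) \<le> card S - 1"
      using card_image_le[of "S - {u}" f] finS uv(1) by simp
    moreover have "0 < card S" using finS S(2) by (simp add: card_gt_0_iff)
    moreover have "card V - 1 \<le> card (D `` {f u})" using D(4) f(2) uv(1) by blast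
    ultimately have "card (f ` (S - {u})) < card (D `` {f u})" by linarith
    then have "\<not> D `` {f u} \<subseteq> f ` (S - {u})"
      using finS card_mono by (metis finite_Diff finite_imageI not_less)
    then obtain y where y: "(f u, y) \<in> D" "y \<notin> f ` (S - {u})" by blast
    have yS: "y \<notin> f ` S" using y D(3) by (auto simp: irrefl_def)
    let ?S = "insert v S" and ?f = "f(v := y)"
    have "\<exists>g. (\<forall>x\<in>?S. g x = ?f x) \<and> inj_on g V \<and> (\<forall>(u, v)\<in>E. (g u, g v) \<in> D)"
    proof (rule less.hyps)
      have "V - ?S \<subset> V - S" using vV uv by blast
      then show "card (V - ?S) < card (V - S)" using V(1) by (simp add: psubset_card_mono)
      show "?S \<subseteq> V" "?S \<noteq> {}" using S vV by auto
      show "connected_in E ?S" by (rule connected_in_insert[OF S(3) uv(1,3) V(3)])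
      show "inj_on ?f ?S" using f(1) yS uv(2) by (auto simp: inj_on_def)
      show "?f ` ?S \<subseteq> Domain D" using f(2) uv(2) y(1) D(2) by (auto dest: symD)
      fix w x assume wx: "w \<in> ?S" "x \<in> ?S" "(w, x) \<in> E"
      have un: "w' = u" if "w' \<in> S" "(w', v) \<in> E" for w'
        using unique_neighbour[OF V(3,5) S(3) uv(2)] that uv by blast
      show "(?f w, ?f x) \<in> D"
      proof (cases "w = v")
        case True
        with wx V(4) have "x \<in> S" "x \<noteq> v" by (auto simp: irrefl_def)
        moreover have "(x, v) \<in> E" using wx True V(3) by (auto dest: symD)
        ultimately show ?thesis using un y(1) True D(2) by (auto dest: symD)
      next
        case False
        with wx un y(1) f(3) show ?thesis by auto
      qed
    qed
    then obtain g where g: "\<forall>x\<in>?S. g x = ?f x" "inj_on g V" "\<forall>(u, v)\<in>E. (g u, g v) \<in> D" by blast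
    have "\<forall>x\<in>S. g x = f x" using g(1) uv(2) by auto
    with g show ?thesis by blast
  qed
qed

section \<open>Simple graphs as symmetric irreflexive relations\<close>

lemma pair_graphD:
  assumes "pair_graph G"
  shows "finite (pverts G)" "finite (parcs G)" "parcs G \<subseteq> pverts G \<times> pverts G"
    "sym (parcs G)" "irrefl (parcs G)" "pair_wf_digraph G"
proof -
  interpret pair_graph G by fact
  show "finite (pverts G)" by (rule pair_finite_verts)
  show "finite (parcs G)" by (rule pair_finite_arcs)
  show "parcs G \<subseteq> pverts G \<times> pverts G" using wellformed' by auto
  show "sym (parcs G)" using arcs_symmetric by (rule symI)
  show "irrefl (parcs G)" using no_loops' by (metis irrefl_def)
  show "pair_wf_digraph G" by (rule pair_wf_digraph_axioms)
qed

lemma pair_graphI: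
  assumes "finite (pverts G)" "parcs G \<subseteq> pverts G \<times> pverts G" "sym (parcs G)" "irrefl (parcs G)"
  shows "pair_graph G"
proof -
  have "finite (parcs G)" using assms(1,2) by (metis finite_SigmaI finite_subset)
  moreover have "fst e \<noteq> snd e" if "e \<in> parcs G" for e
    using assms(4) that by (cases e) (auto simp: irrefl_def)
  moreover have "symmetric (with_proj G)" using assms(3) by (simp add: symmetric_def)
  ultimately show ?thesis using assms(1,2) by unfold_locales auto
qed

section \<open>Deleting the edges at vertices of small degree\<close>

text \<open>
  The non-isolated vertices of a symmetric relation are the elements of its domain.  Each deletion step
  costs fewer than \<open>d\<close> edges and makes at least one vertex isolated.
\<close>

lemma prune_low_degree_aux:
  fixes D :: "'b rel"
  assumes "finite D" "sym D"
  shows "\<exists>D'\<subseteq>D. sym D' \<and> (\<forall>x\<in>Domain D'. d \<le> card (D' `` {x})) \<and>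
    card ((\<lambda>(u, v). {u, v}) ` D) \<le> card ((\<lambda>(u, v). {u, v}) ` D') + d * card (Domain D)"
  using assms
proof (induction "card (Domain D)" arbitrary: D rule: less_induct)
  case less
  let ?e = "\<lambda>(u, v). {u, v}"
  show ?case
  proof (cases "\<forall>x\<in>Domain D. d \<le> card (D `` {x})")
    case True
    with less.prems show ?thesis by (intro exI[of _ D]) auto
  next
    case False
    then obtain x where x: "x \<in> Domain D" "card (D `` {x}) < d" by force
    define D1 where "D1 = {(a, b) \<in> D. a \<noteq> x \<and> b \<noteq> x}"
    have D1: "D1 \<subseteq> D" "sym D1" using less.prems by (auto simp: D1_def sym_def)
    have fin1: "finite D1" using D1 less.prems finite_subset by blast
    have finDom: "finite (Domain D)" using less.prems(1) by (rule finite_Domain)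
    have "Domain D1 \<subseteq> Domain D - {x}" by (auto simp: D1_def)
    then have "card (Domain D1) \<le> card (Domain D - {x})" using finDom by (simp add: card_mono)
    moreover have "Suc (card (Domain D - {x})) = card (Domain D)"
      using card_Suc_Diff1[OF finDom x(1)] .
    ultimately have dom: "Suc (card (Domain D1)) \<le> card (Domain D)" by simp
    then have "card (Domain D1) < card (Domain D)" by simp
    from less.hyps[OF this fin1 D1(2)] obtain D' where D': "D' \<subseteq> D1" "sym D'"
        "\<forall>x\<in>Domain D'. d \<le> card (D' `` {x})"
        "card (?e ` D1) \<le> card (?e ` D') + d * card (Domain D1)"
      by blast
    have finx: "finite (D `` {x})" using less.prems(1) by (rule finite_Image)
    have "?e ` D \<subseteq> ?e ` D1 \<union> (\<lambda>y. {x, y}) ` (D `` {x})"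
    proof
      fix s assume "s \<in> ?e ` D"
      then obtain a b where ab: "s = {a, b}" "(a, b) \<in> D" by auto
      consider "a = x" | "b = x" | "a \<noteq> x" "b \<noteq> x" by blast
      then show "s \<in> ?e ` D1 \<union> (\<lambda>y. {x, y}) ` (D `` {x})"
      proof cases
        case 1
        with ab show ?thesis by auto
      next
        case 2
        with ab less.prems(2) have "s = {x, a}" "(x, a) \<in> D" by (auto dest: symD)
        then show ?thesis by auto
      next
        case 3
        with ab have "(a, b) \<in> D1" by (auto simp: D1_def)
        with ab show ?thesis by force
      qed
    qed
    then have "card (?e ` D) \<le> card (?e ` D1 \<union> (\<lambda>y. {x, y}) ` (D `` {x}))"
      using fin1 finx by (intro card_mono) auto
    also have "\<dots> \<le> card (?e ` D1) + card ((\<lambda>y. {x, y}) ` (D `` {x}))" by (rule card_Un_le)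
    also have "\<dots> \<le> card (?e ` D1) + d"
      using card_image_le[OF finx, of "\<lambda>y. {x, y}"] x(2) by simp
    also have "\<dots> \<le> card (?e ` D') + d * Suc (card (Domain D1))" using D'(4) by simp
    also have "\<dots> \<le> card (?e ` D') + d * card (Domain D)"
      using dom by (intro add_left_mono mult_le_mono2)
    finally show ?thesis using D' D1 by (intro exI[of _ D']) auto
  qed
qed

lemma prune_low_degree:
  assumes "pair_graph H"
  obtains K where "pair_graph K" "pverts K = pverts H" "parcs K \<subseteq> parcs H"
    "\<And>x. x \<in> Domain (parcs K) \<Longrightarrow> d \<le> card (parcs K `` {x})"
    "card (edges H) \<le> card (edges K) + d * card (pverts H)"
proof -
  note H = pair_graphD[OF assms]
  from prune_low_degree_aux[OF H(2,4), of d] obtain D where D: "D \<subseteq> parcs H" "sym D"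
      "\<forall>x\<in>Domain D. d \<le> card (D `` {x})"
      "card (edges H) \<le> card ((\<lambda>(u, v). {u, v}) ` D) + d * card (Domain (parcs H))"
    unfolding edges_def by blast
  have "Domain (parcs H) \<subseteq> pverts H" using H(3) by auto
  then have "card (Domain (parcs H)) \<le> card (pverts H)" using H(1) by (simp add: card_mono)
  then have le: "d * card (Domain (parcs H)) \<le> d * card (pverts H)" by simp
  show thesis
  proof (rule that[of "\<lparr>pverts = pverts H, parcs = D\<rparr>"])
    show "pair_graph \<lparr>pverts = pverts H, parcs = D\<rparr>"
      using H D by (intro pair_graphI) (auto simp: irrefl_def)
    show "card (edges H) \<le> card (edges \<lparr>pverts = pverts H, parcs = D\<rparr>) + d * card (pverts H)"
      using order_trans[OF D(4) add_left_mono[OF le]]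
      by (simp only: edges_def pair_pre_digraph.select_convs)
  qed (use D in auto)
qed

section \<open>Copies as injective homomorphisms\<close>

text \<open>
  An injective map on the vertices that preserves adjacency; its image is a copy of \<open>G\<close> in \<open>H\<close>, not
  necessarily an induced one.  The values of \<open>f\<close> outside \<open>pverts G\<close> are irrelevant.
\<close>

definition embedding :: "('a \<Rightarrow> 'b) \<Rightarrow> 'a pair_pre_digraph \<Rightarrow> 'b pair_pre_digraph \<Rightarrow> bool" where
  "embedding f G H \<longleftrightarrow> inj_on f (pverts G) \<and> f ` pverts G \<subseteq> pverts H \<and>
     (\<forall>(u, v)\<in>parcs G. (f u, f v) \<in> parcs H)"

lemma digraph_iso_with_proj_iff:
  assumes "pair_wf_digraph G"
  shows "digraph_iso (with_proj G) (with_proj G') \<longleftrightarrow>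
    (\<exists>f. inj_on f (pverts G) \<and> G' = \<lparr>pverts = f ` pverts G, parcs = map_prod f f ` parcs G\<rparr>)"
    (is "?L \<longleftrightarrow> ?R")
proof
  assume ?L
  then obtain h where h: "pre_digraph.digraph_isomorphism (with_proj G) h"
      "with_proj G' = app_iso h (with_proj G)"
    unfolding digraph_iso_def by blast
  have th: "iso_tail h = fst" "iso_head h = snd"
    and G': "pverts G' = iso_verts h ` pverts G" "parcs G' = iso_arcs h ` parcs G"
    using h(2) by (auto simp: with_proj_def app_iso_def)
  have arc: "iso_arcs h e = map_prod (iso_verts h) (iso_verts h) e" if "e \<in> parcs G" for e
    using h(1) that th unfolding pre_digraph.digraph_isomorphism_def
    by (auto simp: prod_eq_iff)
  then have "parcs G' = map_prod (iso_verts h) (iso_verts h) ` parcs G"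
    unfolding G' by (intro image_cong) auto
  moreover have "inj_on (iso_verts h) (pverts G)"
    using h(1) unfolding pre_digraph.digraph_isomorphism_def by auto
  ultimately show ?R using G' by (intro exI[of _ "iso_verts h"]) auto
next
  assume ?R
  then obtain f where f: "inj_on f (pverts G)"
      "G' = \<lparr>pverts = f ` pverts G, parcs = map_prod f f ` parcs G\<rparr>" by blast
  interpret pair_wf_digraph G by fact
  have "parcs G \<subseteq> pverts G \<times> pverts G" using wellformed' by auto
  then have inj: "inj_on (map_prod f f) (parcs G)"
    using f(1) map_prod_inj_on inj_on_subset by metis
  let ?h = "\<lparr>iso_verts = f, iso_arcs = map_prod f f, iso_head = snd, iso_tail = fst\<rparr>"
  have "pre_digraph.digraph_isomorphism (with_proj G) ?h"
    using f(1) inj wf_digraph_axioms unfolding pre_digraph.digraph_isomorphism_def by auto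
  moreover have "with_proj G' = app_iso ?h (with_proj G)"
    using f(2) by (simp add: with_proj_def app_iso_def)
  ultimately show ?L unfolding digraph_iso_def by blast
qed

lemma subgraph_with_proj_iff:
  "subgraph (with_proj G) (with_proj H) \<longleftrightarrow>
     pverts G \<subseteq> pverts H \<and> parcs G \<subseteq> parcs H \<and> pair_wf_digraph G \<and> pair_wf_digraph H"
  unfolding subgraph_def by (auto simp: wf_digraph_wp_iff compatible_def)

lemma subgraph_image_iff:
  assumes "pair_wf_digraph G" "pair_wf_digraph H" "inj_on f (pverts G)"
  shows "subgraph (with_proj \<lparr>pverts = f ` pverts G, parcs = map_prod f f ` parcs G\<rparr>) (with_proj H)
    \<longleftrightarrow> embedding f G H"
proof -
  interpret pair_wf_digraph G by fact
  have "pair_wf_digraph \<lparr>pverts = f ` pverts G, parcs = map_prod f f ` parcs G\<rparr>"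
    by unfold_locales (auto dest: wellformed')
  then show ?thesis
    using assms unfolding subgraph_with_proj_iff embedding_def by auto
qed

lemma contains_copy_iff:
  assumes "pair_wf_digraph G" "pair_wf_digraph H"
  shows "contains_copy H G \<longleftrightarrow> (\<exists>f. embedding f G H)"
  unfolding contains_copy_def digraph_iso_with_proj_iff[OF assms(1)]
  using subgraph_image_iff[OF assms] by (metis embedding_def)

lemma contains_proper_copy_iff:
  assumes "pair_wf_digraph G" "pair_wf_digraph H"
  shows "contains_proper_copy H G \<longleftrightarrow>
    (\<exists>f. embedding f G H \<and> \<lparr>pverts = f ` pverts G, parcs = map_prod f f ` parcs G\<rparr> \<noteq> H)"
  unfolding contains_proper_copy_def digraph_iso_with_proj_iff[OF assms(1)]
  using subgraph_image_iff[OF assms] by (metis embedding_def)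

lemma pair_wf_cycle_graph: "pair_wf_digraph (cycle_graph i)"
  by unfold_locales (auto simp: cycle_graph_def)

text \<open>Copies of \<open>C\<^sub>i\<close> are the circuits with \<open>i\<close> vertices.\<close>

lemma contains_cycle_iff:
  assumes "pair_wf_digraph H" "sym (parcs H)" "3 \<le> i"
  shows "contains_copy H (cycle_graph i) \<longleftrightarrow> (\<exists>p. circuit (parcs H) p \<and> length p = i)"
proof
  assume "contains_copy H (cycle_graph i)"
  then obtain f where f: "embedding f (cycle_graph i) H"
    using contains_copy_iff[OF pair_wf_cycle_graph assms(1)] by blast
  have arc: "(f a, f b) \<in> parcs H" if "a < i" "b < i" "b = (a + 1) mod i" for a b
    using f that unfolding embedding_def cycle_graph_def by auto
  let ?p = "map f [0..<i]"
  have "distinct ?p" using f unfolding embedding_def cycle_graph_def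
    by (auto simp: distinct_map atLeast0LessThan)
  moreover have "successively (\<lambda>x y. (x, y) \<in> parcs H) ?p"
    unfolding successively_conv_nth
  proof (intro allI impI)
    fix a assume "Suc a < length ?p"
    then have a: "Suc a < i" by simp
    then have "(f a, f (Suc a)) \<in> parcs H" by (intro arc) auto
    with a show "(?p ! a, ?p ! Suc a) \<in> parcs H" by simp
  qed
  moreover have "(last ?p, hd ?p) \<in> parcs H"
  proof -
    have "(f (i - 1), f 0) \<in> parcs H" using assms(3) by (intro arc) auto
    then show ?thesis using assms(3) by (simp add: last_map hd_map)
  qed
  ultimately have "circuit (parcs H) ?p" using assms(3) by (simp add: circuit_def path_in_def)
  then show "\<exists>p. circuit (parcs H) p \<and> length p = i" by (intro exI[of _ ?p]) auto
next
  assume "\<exists>p. circuit (parcs H) p \<and> length p = i"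
  then obtain p where p: "circuit (parcs H) p" "length p = i" by blast
  interpret pair_wf_digraph H by fact
  have arc: "(p ! a, p ! b) \<in> parcs H" if "a < i" "b = (a + 1) mod i" for a b
  proof (cases "a + 1 = i")
    case True
    then have ab: "a = length p - 1" "b = 0" "p \<noteq> []" using that p(2) by auto
    then have "p ! a = last p" "p ! b = hd p" by (simp_all add: last_conv_nth hd_conv_nth)
    then show ?thesis using p(1) by (simp add: circuit_def)
  next
    case False
    with that have "b = Suc a" "Suc a < length p" using p(2) by auto
    with p(1) show ?thesis unfolding circuit_def path_in_def by (simp add: successively_conv_nth)
  qed
  have "embedding ((!) p) (cycle_graph i) H"
    unfolding embedding_def
  proof (intro conjI)
    show "inj_on ((!) p) (pverts (cycle_graph i))"
      using p unfolding circuit_def path_in_def cycle_graph_def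
      by (auto simp: inj_on_def nth_eq_iff_index_eq)
    show "(!) p ` pverts (cycle_graph i) \<subseteq> pverts H"
    proof
      fix x assume "x \<in> (!) p ` pverts (cycle_graph i)"
      then obtain a where a: "a < i" "x = p ! a" by (auto simp: cycle_graph_def)
      from arc[OF a(1) refl] show "x \<in> pverts H" unfolding a(2) by (rule wellformed')
    qed
    show "\<forall>(u, v)\<in>parcs (cycle_graph i). (p ! u, p ! v) \<in> parcs H"
    proof (clarify)
      fix u v assume "(u, v) \<in> parcs (cycle_graph i)"
      then have "u < i" "v < i" "v = (u + 1) mod i \<or> u = (v + 1) mod i"
        by (auto simp: cycle_graph_def)
      with arc assms(2) show "(p ! u, p ! v) \<in> parcs H" by (meson symD)
    qed
  qed
  then show "contains_copy H (cycle_graph i)"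
    using contains_copy_iff[OF pair_wf_cycle_graph assms(1)] by blast
qed

lemma no_short_cycles_iff:
  assumes "pair_graph H"
  shows "(\<forall>F\<in>cycle_graph ` {3..m}. \<not> contains_copy H F) \<longleftrightarrow>
    (\<nexists>p. circuit (parcs H) p \<and> length p \<le> m)"
  using contains_cycle_iff[OF pair_graphD(6,4)[OF assms]]
  by (auto simp: circuit_def)

section \<open>Trees and their diameter\<close>

lemma undirected_treeD:
  assumes "undirected_tree T"
  shows "pair_graph T" "\<nexists>c. circuit (parcs T) c"
proof -
  show T: "pair_graph T" using assms unfolding undirected_tree_def by blast
  have "\<forall>i\<ge>3. \<nexists>p. circuit (parcs T) p \<and> length p = i"
    using assms contains_cycle_iff[OF pair_graphD(6,4)[OF T]] unfolding undirected_tree_def by blast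
  then show "\<nexists>c. circuit (parcs T) c" by (auto simp: circuit_def)
qed

lemma (in pair_wf_digraph) apath_imp_path_in:
  assumes "apath u p v"
  shows "path_in (parcs G) (pawalk_verts u p) \<and> hd (pawalk_verts u p) = u \<and>
    last (pawalk_verts u p) = v \<and> length (pawalk_verts u p) = Suc (length p)"
  using assms
proof (induction p arbitrary: u)
  case Nil
  then show ?case by (auto simp: path_in_def apath_simps)
next
  case (Cons e p)
  then have IH: "path_in (parcs G) (pawalk_verts (snd e) p)" "hd (pawalk_verts (snd e) p) = snd e"
      "last (pawalk_verts (snd e) p) = v" "length (pawalk_verts (snd e) p) = Suc (length p)"
    and e: "e \<in> parcs G" "fst e = u" "fst e \<notin> set (pawalk_verts (snd e) p)"
    by (auto simp: apath_simps)
  have "pawalk_verts (snd e) p \<noteq> []" using IH(4) by auto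
  with IH e show ?case by (auto simp: path_in_def successively_Cons)
qed

text \<open>
  In a connected graph, the distance of two vertices is attained by a path.  A path with \<open>m\<close> vertices has
  length \<open>m - 1\<close>.
\<close>

lemma mu_eq_shortest_path_in:
  assumes "pair_graph T" "Digraph_Component.connected (with_proj T)" "u \<in> pverts T" "v \<in> pverts T"
  obtains p where "path_in (parcs T) p" "hd p = u" "last p = v" "p \<noteq> []"
    "wf_digraph.\<mu> (with_proj T) (\<lambda>_. 1) u v = ereal (real (length p - 1))"
proof -
  interpret pair_graph T by fact
  have "strongly_connected (with_proj T)"
    using symmetric_connected_imp_strongly_connected assms(2) sym_arcs by auto
  then have "u \<rightarrow>\<^sup>*\<^bsub>with_proj T\<^esub> v" using assms(3,4) unfolding strongly_connected_def by auto
  then obtain a where a: "apath u a v" "\<mu> (\<lambda>_. 1) u v = awalk_cost (\<lambda>_. 1) a"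
    using min_cost_awalk[of u v "\<lambda>_. 1"] by auto
  have "awalk_cost (\<lambda>_. 1) a = real (length a)"
    by (simp add: awalk_cost_def sum_list_triv)
  with apath_imp_path_in[OF a(1)] a(2) show thesis
    by (intro that[of "pawalk_verts u a"]) auto
qed

lemma diameter_paths:
  assumes "pair_graph T" "Digraph_Component.connected (with_proj T)"
    and "graph_diameter T = ereal (real k)"
  shows "\<And>u v. u \<in> pverts T \<Longrightarrow> v \<in> pverts T \<Longrightarrow>
      \<exists>p. path_in (parcs T) p \<and> hd p = u \<and> last p = v \<and> p \<noteq> [] \<and> length p \<le> k + 1"
    and "\<exists>p. path_in (parcs T) p \<and> p \<noteq> [] \<and> set p \<subseteq> pverts T \<and> k + 1 \<le> length p"
proof -
  let ?mu = "wf_digraph.\<mu> (with_proj T) (\<lambda>_. 1)"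
  have D: "ereal (real k) = (SUP u \<in> pverts T. SUP v \<in> pverts T. ?mu u v)"
    using assms(3) unfolding graph_diameter_def by simp
  fix u v assume uv: "u \<in> pverts T" "v \<in> pverts T"
  obtain p where p: "path_in (parcs T) p" "hd p = u" "last p = v" "p \<noteq> []"
      "?mu u v = ereal (real (length p - 1))"
    using mu_eq_shortest_path_in[OF assms(1,2) uv] .
  have "?mu u v \<le> ereal (real k)" unfolding D using uv by (meson SUP_upper2 SUP_upper)
  with p show "\<exists>p. path_in (parcs T) p \<and> hd p = u \<and> last p = v \<and> p \<noteq> [] \<and> length p \<le> k + 1"
    by (intro exI[of _ p]) auto
next
  let ?mu = "wf_digraph.\<mu> (with_proj T) (\<lambda>_. 1)"
  show "\<exists>p. path_in (parcs T) p \<and> p \<noteq> [] \<and> set p \<subseteq> pverts T \<and> k + 1 \<le> length p"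
  proof (rule ccontr)
    \<comment> \<open>If all paths had at most \<open>k\<close> vertices, then all distances would be at most \<open>k - 1\<close>.\<close>
    assume *: "\<not> ?thesis"
    have le: "?mu u v \<le> ereal (real k - 1)" if uv: "u \<in> pverts T" "v \<in> pverts T" for u v
    proof -
      obtain p where p: "path_in (parcs T) p" "hd p = u" "last p = v" "p \<noteq> []"
          "?mu u v = ereal (real (length p - 1))"
        using mu_eq_shortest_path_in[OF assms(1,2) uv] .
      have "set p \<subseteq> pverts T"
      proof
        fix x assume "x \<in> set p"
        then obtain i where i: "i < length p" "x = p ! i" by (auto simp: in_set_conv_nth)
        show "x \<in> pverts T"
        proof (cases i)
          case 0
          with i p uv show ?thesis by (simp add: hd_conv_nth)
        next
          case (Suc j)
          with i p(1) have "(p ! j, x) \<in> parcs T"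
            unfolding path_in_def by (auto simp: successively_conv_nth)
          then show ?thesis using pair_graphD(3)[OF assms(1)] by auto
        qed
      qed
      with * p have "length p \<le> k" by (metis Suc_eq_plus1 not_less_eq_eq)
      with p(4) have "real (length p - 1) \<le> real k - 1" by (cases p) auto
      with p(5) show ?thesis by simp
    qed
    have "graph_diameter T \<le> ereal (real k - 1)"
      unfolding graph_diameter_def by (intro SUP_least le)
    with assms(3) show False by simp
  qed
qed

section \<open>Short circuits and non-induced copies of a tree\<close>

text \<open>
  An extra edge between the images of two non-adjacent vertices of \<open>T\<close> closes the image of the path
  between them to a circuit with at most \<open>k + 1\<close> vertices.
\<close>

lemma no_proper_copy_if_no_short_circuit:
  assumes "undirected_tree T" "graph_diameter T = ereal (real k)"
    and "pair_graph F" "card (pverts F) = card (pverts T)"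
    and "\<nexists>c. circuit (parcs F) c \<and> length c \<le> k + 1"
  shows "\<not> contains_proper_copy F T"
proof
  note T = undirected_treeD[OF assms(1)] and F = pair_graphD[OF assms(3)]
  note T' = pair_graphD[OF T(1)]
  have conn: "Digraph_Component.connected (with_proj T)"
    using assms(1) unfolding undirected_tree_def by blast
  assume "contains_proper_copy F T"
  then obtain f where f: "embedding f T F"
      "\<lparr>pverts = f ` pverts T, parcs = map_prod f f ` parcs T\<rparr> \<noteq> F"
    using contains_proper_copy_iff[OF T'(6) F(6)] by blast
  have inj: "inj_on f (pverts T)" and hom: "\<And>u v. (u, v) \<in> parcs T \<Longrightarrow> (f u, f v) \<in> parcs F"
    using f(1) unfolding embedding_def by auto
  have onto: "f ` pverts T = pverts F"
    using f(1) F(1) assms(4) card_image[OF inj] unfolding embedding_def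
    by (intro card_subset_eq) auto
  have "map_prod f f ` parcs T \<subseteq> parcs F" using hom by auto
  with f(2) onto obtain a b where ab: "(a, b) \<in> parcs F" "(a, b) \<notin> map_prod f f ` parcs T"
    by (cases F) fastforce
  obtain u v where uv: "u \<in> pverts T" "v \<in> pverts T" "a = f u" "b = f v"
  proof -
    have "a \<in> f ` pverts T" "b \<in> f ` pverts T" using ab(1) F(3) onto by auto
    then show thesis using that by blast
  qed
  have ne: "u \<noteq> v" using ab(1) uv F(5) by (auto simp: irrefl_def)
  have nadj: "(u, v) \<notin> parcs T" using ab(2) uv by force
  obtain p where p: "path_in (parcs T) p" "hd p = u" "last p = v" "p \<noteq> []" "length p \<le> k + 1"
    using diameter_paths(1)[OF T(1) conn assms(2) uv(1,2)] by blast
  have len: "3 \<le> length p"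
  proof (rule ccontr)
    assume "\<not> 3 \<le> length p"
    then consider "length p = 0" | "length p = 1" | "length p = 2" by linarith
    then show False
      using p ne nadj by cases (auto simp: length_Suc_conv numeral_2_eq_2 path_in_def)
  qed
  have "set p \<subseteq> pverts T"
  proof
    fix x assume "x \<in> set p"
    then have "(u, x) \<in> (Restr (parcs T) (set p))\<^sup>*"
      using path_in_connected_in[OF p(1) T'(4)] p(2,4) unfolding connected_in_def by auto
    then show "x \<in> pverts T" using uv(1) T'(3) by (auto elim: rtranclE)
  qed
  then have "path_in (parcs F) (map f p)"
    using path_in_map[OF p(1), of f "parcs F"] hom inj inj_on_subset by blast
  moreover have "(last (map f p), hd (map f p)) \<in> parcs F"
    using ab(1) uv p(2-4) F(4) by (auto simp: last_map hd_map dest: symD)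
  ultimately have "circuit (parcs F) (map f p)" using len by (simp add: circuit_def)
  with assms(5) p(5) show False by auto
qed

text \<open>
  A short circuit lets a path of \<open>T\<close> be wrapped around it.  Extending this to all of \<open>T\<close> gives a copy of
  \<open>T\<close> whose vertices also span the closing edge of the circuit, which is not an edge of the copy.
\<close>

lemma no_short_circuit_if_large_degree:
  assumes "undirected_tree T" "graph_diameter T = ereal (real k)"
    and "pair_graph K" "\<And>x. x \<in> Domain (parcs K) \<Longrightarrow> card (pverts T) - 1 \<le> card (parcs K `` {x})"
    and induced: "\<And>F. pair_graph F \<Longrightarrow> subgraph (with_proj F) (with_proj K) \<Longrightarrow>
      card (pverts F) = card (pverts T) \<Longrightarrow> \<not> contains_proper_copy F T"
  shows "\<nexists>c. circuit (parcs K) c \<and> length c \<le> k + 1"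
proof
  assume "\<exists>c. circuit (parcs K) c \<and> length c \<le> k + 1"
  then obtain c where c: "circuit (parcs K) c" "length c \<le> k + 1" by blast
  note T = undirected_treeD[OF assms(1)] and K = pair_graphD[OF assms(3)]
  note T' = pair_graphD[OF T(1)]
  have conn: "Digraph_Component.connected (with_proj T)"
    using assms(1) unfolding undirected_tree_def by blast
  have c': "path_in (parcs K) c" "3 \<le> length c" "(last c, hd c) \<in> parcs K"
    using c unfolding circuit_def by auto
  obtain p0 where p0: "path_in (parcs T) p0" "p0 \<noteq> []" "set p0 \<subseteq> pverts T" "k + 1 \<le> length p0"
    using diameter_paths(2)[OF T(1) conn assms(2)] by blast
  define p where "p = take (length c) p0"
  have p: "path_in (parcs T) p" "length p = length c" "set p \<subseteq> pverts T"
    using p0 c(2) path_in_take set_take_subset[of "length c" p0] unfolding p_def by auto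
  have pne: "p \<noteq> []" "c \<noteq> []" using p(2) c'(2) by auto
  obtain f where f: "map f p = c"
      "\<forall>u\<in>set p. \<forall>v\<in>set p. (u, v) \<in> parcs T \<longrightarrow> (f u, f v) \<in> parcs K"
    using map_path_onto_path[OF T'(4,5) T(2) K(4) p(1) c'(1) p(2)] by blast
  have "f ` set p = set c" using f(1) by (metis set_map)
  moreover have "x \<in> Domain (parcs K)" if "x \<in> set c" for x
  proof -
    have "(x, last c) \<in> (Restr (parcs K) (set c))\<^sup>*"
      using path_in_connected_in[OF c'(1) K(4)] that pne unfolding connected_in_def by auto
    then show ?thesis using c'(3) by (auto elim: converse_rtranclE)
  qed
  ultimately have dom: "f ` set p \<subseteq> Domain (parcs K)" by auto
  have injp: "inj_on f (set p)"
    using f(1) c'(1) unfolding path_in_def by (metis distinct_map)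
  have reach: "(a, b) \<in> (parcs T)\<^sup>*" if ab: "a \<in> pverts T" "b \<in> pverts T" for a b
  proof -
    obtain r where r: "path_in (parcs T) r" "hd r = a" "last r = b" "r \<noteq> []"
      using diameter_paths(1)[OF T(1) conn assms(2) ab] by blast
    have "(a, b) \<in> (Restr (parcs T) (set r))\<^sup>*"
      using path_in_connected_in[OF r(1) T'(4)] r unfolding connected_in_def by auto
    then show ?thesis by (meson inf_le1 rtrancl_mono subsetD)
  qed
  obtain g where g: "\<forall>x\<in>set p. g x = f x" "inj_on g (pverts T)"
      "\<forall>(u, v)\<in>parcs T. (g u, g v) \<in> parcs K"
    using extend_tree_embedding[OF T'(1,3,4,5) T(2) reach K(2,4,5) assms(4) p(3) _
        path_in_connected_in[OF p(1) T'(4)] injp dom] f(2) pne by auto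
  define F where "F = \<lparr>pverts = g ` pverts T, parcs = Restr (parcs K) (g ` pverts T)\<rparr>"
  have gK: "g ` pverts T \<subseteq> pverts K"
  proof -
    have "g x \<in> pverts K" if x: "x \<in> pverts T" for x
    proof (cases "x \<in> set p")
      case True
      then show ?thesis using g(1) dom K(3) by auto
    next
      case False
      have "(x, hd p) \<in> (parcs T)\<^sup>*" using reach[OF x, of "hd p"] p(3) hd_in_set[OF pne(1)] by blast
      moreover have "x \<noteq> hd p" using False pne by auto
      ultimately obtain y where "(x, y) \<in> parcs T" by (auto elim: converse_rtranclE)
      then show ?thesis using g(3) K(3) by auto
    qed
    then show ?thesis by auto
  qed
  have F: "pair_graph F"
    using K T'(1) unfolding F_def
    by (intro pair_graphI) (auto simp: irrefl_def sym_def)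
  have FK: "subgraph (with_proj F) (with_proj K)"
    using gK pair_graphD(6)[OF F] K(6) unfolding subgraph_with_proj_iff by (auto simp: F_def)
  have cardF: "card (pverts F) = card (pverts T)" using g(2) by (simp add: F_def card_image)
  have "embedding g T F"
    using g(2,3) T'(3) unfolding embedding_def F_def by auto
  moreover have "\<lparr>pverts = g ` pverts T, parcs = map_prod g g ` parcs T\<rparr> \<noteq> F"
  proof
    assume eq: "\<lparr>pverts = g ` pverts T, parcs = map_prod g g ` parcs T\<rparr> = F"
    have ends: "hd p \<in> set p" "last p \<in> set p" using pne by auto
    then have endsT: "hd p \<in> pverts T" "last p \<in> pverts T" using p(3) by auto
    have "g (hd p) = hd c" "g (last p) = last c"
      using g(1) ends pne hd_map[of p f] last_map[of p f] unfolding f(1) by simp_all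
    then have "(g (hd p), g (last p)) \<in> parcs K" using c'(3) K(4) by (auto dest: symD)
    then have "(g (hd p), g (last p)) \<in> parcs F" using endsT unfolding F_def by simp
    then have "(g (hd p), g (last p)) \<in> map_prod g g ` parcs T"
      using eq by (metis pair_pre_digraph.select_convs(2))
    then obtain u v where uv: "(u, v) \<in> parcs T" "g (hd p) = g u" "g (last p) = g v" by auto
    then have "hd p = u" "last p = v" using T'(3) endsT by (auto dest: inj_onD[OF g(2)])
    with uv(1) ends_not_adjacent[OF T'(4) T(2) p(1)] p(2) c'(2) show False by auto
  qed
  ultimately have "contains_proper_copy F T"
    using contains_proper_copy_iff[OF T'(6) pair_graphD(6)[OF F]] by blast
  with induced[OF F FK cardF] show False by blast
qed

section \<open>The extremal numbers\<close>

text \<open>Both extremal numbers are maxima of sets of this form.\<close>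

lemma finite_edge_counts:
  "finite {card (edges H) | H :: nat pair_pre_digraph. pair_graph H \<and> card (pverts H) = n \<and> P H}"
proof (rule finite_subset)
  show "{card (edges H) | H :: nat pair_pre_digraph. pair_graph H \<and> card (pverts H) = n \<and> P H}
      \<subseteq> {..2 ^ n}"
  proof
    fix m
    assume "m \<in> {card (edges H) | H :: nat pair_pre_digraph.
      pair_graph H \<and> card (pverts H) = n \<and> P H}"
    then obtain H :: "nat pair_pre_digraph"
      where H: "m = card (edges H)" "pair_graph H" "card (pverts H) = n" by blast
    note H' = pair_graphD[OF H(2)]
    have "edges H \<subseteq> Pow (pverts H)" using H'(3) unfolding edges_def by auto
    then have "card (edges H) \<le> card (Pow (pverts H))" using H'(1) by (intro card_mono) auto
    then show "m \<in> {..2 ^ n}" using H H'(1) by (simp add: card_Pow)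
  qed
qed simp

theorem theorem15:
  fixes T :: "'a pair_pre_digraph" and k q n :: nat
  assumes "undirected_tree T"
    and "graph_diameter T = ereal (real k)" and "k \<ge> 2"
    and "card (pverts T) = q" and "q \<ge> k + 1" and "k + 1 \<ge> 3"
    and "n \<ge> q"
  shows "ex_number n (cycle_graph ` {3..k + 1}) \<le> st_number n T \<and>
         st_number n T \<le> ex_number n (cycle_graph ` {3..k + 1}) + (q - 1) * n"
proof -
  let ?P = "\<lambda>H :: nat pair_pre_digraph. \<forall>F\<in>cycle_graph ` {3..k + 1}. \<not> contains_copy H F"
  let ?Q = "\<lambda>H :: nat pair_pre_digraph. \<forall>F :: nat pair_pre_digraph.
      pair_graph F \<and> subgraph (with_proj F) (with_proj H) \<and> card (pverts F) = card (pverts T)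
      \<longrightarrow> \<not> contains_proper_copy F T"
  define A where "A = {card (edges H) | H. pair_graph H \<and> card (pverts H) = n \<and> ?P H}"
  define B where "B = {card (edges H) | H. pair_graph H \<and> card (pverts H) = n \<and> ?Q H}"
  have ex: "ex_number n (cycle_graph ` {3..k + 1}) = Max A" by (simp add: ex_number_def A_def)
  have st: "st_number n T = Max B" by (simp add: st_number_def B_def)
  have fin: "finite A" "finite B" unfolding A_def B_def by (rule finite_edge_counts)+
  have AB: "A \<subseteq> B"
  proof -
    have "?Q H" if H: "pair_graph H" "?P H" for H
    proof (intro allI impI, elim conjE)
      fix F :: "nat pair_pre_digraph"
      assume F: "pair_graph F" "subgraph (with_proj F) (with_proj H)"
        "card (pverts F) = card (pverts T)"
      have FH: "parcs F \<subseteq> parcs H" using F(2) by (simp add: subgraph_with_proj_iff)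
      have "\<nexists>c. circuit (parcs H) c \<and> length c \<le> k + 1"
        using H(2) unfolding no_short_cycles_iff[OF H(1)] .
      then have "\<nexists>c. circuit (parcs F) c \<and> length c \<le> k + 1"
        using circuit_mono[OF _ FH] by blast
      then show "\<not> contains_proper_copy F T"
        by (rule no_proper_copy_if_no_short_circuit[OF assms(1,2) F(1,3)])
    qed
    then show ?thesis unfolding A_def B_def by blast
  qed
  have ne: "A \<noteq> {}"
  proof -
    let ?E = "\<lparr>pverts = {..<n}, parcs = {}\<rparr> :: nat pair_pre_digraph"
    have E: "pair_graph ?E" by (rule pair_graphI) (auto simp: sym_def irrefl_def)
    moreover have "?P ?E" unfolding no_short_cycles_iff[OF E] by (simp add: circuit_def)
    ultimately have "card (edges ?E) \<in> A" unfolding A_def by (intro CollectI exI[of _ ?E]) auto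
    then show ?thesis by blast
  qed
  have "Max B \<le> Max A + (q - 1) * n"
  proof (rule Max.boundedI[OF fin(2)])
    show "B \<noteq> {}" using AB ne by blast
  next
    fix m assume "m \<in> B"
    then obtain H where H: "m = card (edges H)" "pair_graph H" "card (pverts H) = n" "?Q H"
      unfolding B_def by blast
    obtain K where K: "pair_graph K" "pverts K = pverts H" "parcs K \<subseteq> parcs H"
        "\<And>x. x \<in> Domain (parcs K) \<Longrightarrow> q - 1 \<le> card (parcs K `` {x})"
        "card (edges H) \<le> card (edges K) + (q - 1) * card (pverts H)"
      using prune_low_degree[OF H(2)] by metis
    have "\<nexists>c. circuit (parcs K) c \<and> length c \<le> k + 1"
    proof (rule no_short_circuit_if_large_degree[OF assms(1,2) K(1)])
      show "card (pverts T) - 1 \<le> card (parcs K `` {x})" if "x \<in> Domain (parcs K)" for x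
        using K(4)[OF that] assms(4) by simp
      fix F assume F: "pair_graph F" "subgraph (with_proj F) (with_proj K)"
        "card (pverts F) = card (pverts T)"
      then have "subgraph (with_proj F) (with_proj H)"
        using K(2,3) pair_graphD(6)[OF H(2)] by (auto simp: subgraph_with_proj_iff)
      with H(4) F show "\<not> contains_proper_copy F T" by blast
    qed
    then have "?P K" unfolding no_short_cycles_iff[OF K(1)] .
    then have "card (edges K) \<in> A" using K(1,2) H(3) unfolding A_def by auto
    then have "card (edges K) \<le> Max A" using fin(1) by simp
    with K(5) H(1,3) show "m \<le> Max A + (q - 1) * n" by simp
  qed
  moreover have "Max A \<le> Max B" using Max_mono[OF AB ne fin(2)] .
  ultimately show ?thesis unfolding ex st by blast
qed

end
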